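(* Let $V\subset\mathbb{R}^n$ be a tropical prevariety given by $k$ tropical polynomials in $n$ variables with tropical degrees bounded by $d$ and with finite coefficients. Then the number of connected components of $V$ is not greater than $$\frac{d^n}{k-n+1}\binom{k+n-1}{n}.$$
   Context: A tropical polynomial $f$ in $n$ variables is given by a nonempty finite set of tropical monomials $Q_j(x)=a_j+i_{j1}x_1+\cdots+i_{jn}x_n$ with $a_j\in\mathbb{R}$ and pairwise distinct exponent vectors $(i_{j1},\dots,i_{jn})\in\mathbb{Z}_{\ge 0}^n$; $f(x)=\min_j Q_j(x)$. The tropical degree of $Q_j$ is $i_{j1}+\cdots+i_{jn}$, and the tropical degree of $f$ is the maximum of the degrees of its monomials. A tropical polynomial of tropical degree $e$ has finite coefficients if every monomial of tropical degree at most $e$ occurs in it. A point $x\in\mathbb{R}^n$ is a tropical zero of $f$ if $\min_j Q_j(x)$ is attained for at least two different values of $j$. The tropical prevariety given by $f_1,\dots,f_k$ is the set of all $x\in\mathbb{R}^n$ that are tropical zeros of every $f_i$.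
   Formalization: The formal theorem assumes k ≥ n (with n ≥ 1): for k = n−1 the bound is undefined, and for k < n−1 it is false, e.g. n=3, k=1, d=1 gives the bound −1 while V is a nonempty tropical plane. *)

theory Defs
  imports "HOL-Analysis.Analysis"
begin

text \<open>
  A tropical polynomial is a partial map from exponent vectors to real coefficients: a vector outside
  the domain is a monomial that does not occur (coefficient infinity). The map representation makes
  the exponent vectors of the monomials pairwise distinct.
\<close>

type_synonym 'n tropical_poly = "(nat ^ 'n) \<Rightarrow> real option"

definition tropical_polynomial :: "'n::finite tropical_poly \<Rightarrow> bool" where
  "tropical_polynomial f \<longleftrightarrow> finite (dom f) \<and> dom f \<noteq> {}"

definition monomial_value :: "'n::finite tropical_poly \<Rightarrow> nat ^ 'n \<Rightarrow> real ^ 'n \<Rightarrow> real" where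
  "monomial_value f I x = the (f I) + (\<Sum>j\<in>UNIV. real (I $ j) * x $ j)"

definition tropical_value :: "'n::finite tropical_poly \<Rightarrow> real ^ 'n \<Rightarrow> real" where
  "tropical_value f x = Min ((\<lambda>I. monomial_value f I x) ` dom f)"

definition monomial_degree :: "nat ^ 'n::finite \<Rightarrow> nat" where
  "monomial_degree I = (\<Sum>j\<in>UNIV. I $ j)"

definition tropical_degree :: "'n::finite tropical_poly \<Rightarrow> nat" where
  "tropical_degree f = Max (monomial_degree ` dom f)"

definition finite_coefficients :: "'n::finite tropical_poly \<Rightarrow> bool" where
  "finite_coefficients f \<longleftrightarrow> (\<forall>I. monomial_degree I \<le> tropical_degree f \<longrightarrow> I \<in> dom f)"

definition tropical_zero :: "'n::finite tropical_poly \<Rightarrow> real ^ 'n \<Rightarrow> bool" where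
  "tropical_zero f x \<longleftrightarrow>
    (\<exists>I\<in>dom f. \<exists>J\<in>dom f. I \<noteq> J \<and>
      monomial_value f I x = tropical_value f x \<and> monomial_value f J x = tropical_value f x)"

definition tropical_prevariety :: "nat \<Rightarrow> (nat \<Rightarrow> 'n::finite tropical_poly) \<Rightarrow> (real ^ 'n) set" where
  "tropical_prevariety k f = {x. \<forall>i<k. tropical_zero (f i) x}"

end

theory Submission
  imports Defs "HOL-Library.Multiset"
begin

text \<open>
  Every connected component of \<open>V\<close> contains a vertex, a point that is the only one at which all its
  tight (minimum attaining) monomials are tied (\<open>component_contains_vertex\<close>): within a component one
  can move along a line until another monomial becomes tight, and with finite coefficients no line
  avoids this in both directions. So it suffices to bound the number of vertices.

  Send the monomial \<open>I\<close> of the \<open>i\<close>-th polynomial to the lattice point \<open>(e\<^sub>i, I)\<close> of \<open>\<int>\<^sup>k \<times> \<int>\<^sup>n\<close>. The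
  coefficients of the polynomials are heights over these points, and the points that are tight at a
  vertex span a full-dimensional cone of the regular subdivision induced by the heights; cones of different vertices
  have disjoint interiors (\<open>totals_disjoint\<close>). Since every polynomial has two tight monomials at a
  point of \<open>V\<close>, the cone of a vertex contains \<open>k - n + 1\<close> simplicial cones with disjoint interiors
  (\<open>many_disjoint_cells\<close>): if \<open>k\<close> nonzero vectors span a space of dimension \<open>r \<le> n\<close>, then at least
  \<open>k - r + 1\<close> subsets of them are bases of it, and each gives one simplicial cone.

  Finally the number of simplicial cones is bounded by volume, which is measured by counting lattice points
  (\<open>card_disjoint_cells_le\<close>). A simplicial cone with lattice generators \<open>(e\<^sub>i, I)\<close> contains in its
  interior all positive integral combinations of its \<open>k + n\<close> generators, about \<open>N\<^bsup>k+n-1\<^esup> / (k+n-1)!\<close> of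
  them with \<open>N\<close> summands. All of them are pairs \<open>(\<lambda>, y)\<close> of nonnegative integral vectors with
  \<open>\<Sum> \<lambda>\<^sub>i = N\<close> and \<open>\<Sum> y\<^sub>j \<le> d N\<close>, of which there are about
  \<open>N\<^bsup>k-1\<^esup> / (k-1)! \<cdot> (d N)\<^sup>n / n!\<close>. Hence there are at most \<open>d\<^sup>n (k+n-1 choose n)\<close> simplicial cones, and
  division by \<open>k - n + 1\<close> gives the bound.
\<close>

section \<open>Lattice simplices and their open cones\<close>

definition exponent_vec :: "nat ^ 'n::finite \<Rightarrow> real ^ 'n" where
  "exponent_vec I = (\<chi> j. real (I $ j))"

text \<open>
  A pair \<open>(i, I)\<close> stands for the monomial with exponent vector \<open>I\<close> of the \<open>i\<close>-th polynomial and is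
  identified with the lattice point \<open>(e\<^sub>i, I)\<close> of \<open>\<int>\<^sup>k \<times> \<int>\<^sup>n\<close> (the Cayley embedding).
  The sign is chosen so that \<open>x\<close> with values \<open>z i\<close> of the polynomials satisfies
  \<open>affine_form z x (i, I) \<le> the (f i I)\<close>, with equality exactly when the monomial attains the minimum.
\<close>

definition affine_form :: "(nat \<Rightarrow> real) \<Rightarrow> real ^ 'n::finite \<Rightarrow> nat \<times> (nat ^ 'n) \<Rightarrow> real" where
  "affine_form z x p = z (fst p) - exponent_vec (snd p) \<bullet> x"

text \<open>
  A multiset of pairs is a nonnegative integral combination of the points \<open>(e\<^sub>i, I)\<close>. Its first component
  is kept as a multiset of indices, which represents a vector of \<open>\<nat>\<^sup>k\<close> although \<open>k\<close> is not a type.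
\<close>

definition total :: "(nat \<times> (nat ^ 'n::finite)) multiset \<Rightarrow> nat multiset \<times> (nat ^ 'n)" where
  "total T = (image_mset fst T, sum_mset (image_mset snd T))"

text \<open>
  Demanding that every element of \<open>S\<close> occurs keeps these lattice points in the interior of the cone
  over \<open>S\<close>; the cones over neighbouring cells share boundary points only.
\<close>

definition totals :: "nat \<Rightarrow> (nat \<times> (nat ^ 'n::finite)) set \<Rightarrow> (nat multiset \<times> (nat ^ 'n)) set" where
  "totals N S = total ` {T. set_mset T = S \<and> size T = N}"

text \<open>
  Tightness of all elements of such a set fixes the point \<open>x\<close>, that is, the differences of exponent
  vectors with a common first component span \<open>\<real>\<^sup>n\<close>. A point of the prevariety whose tight monomials
  form a determining set is a vertex.
\<close>

definition determining :: "(nat \<times> (nat ^ 'n::finite)) set \<Rightarrow> bool" where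
  "determining S \<longleftrightarrow> (\<forall>z x. (\<forall>p\<in>S. affine_form z x p = 0) \<longrightarrow> x = 0)"

text \<open>
  The cardinality is \<open>dim (\<real>\<^sup>k \<times> \<real>\<^sup>n)\<close>, so a cell is a basis of that space: the vertex set of a full-dimensional
  lattice simplex of the Cayley polytope.
\<close>

definition cell :: "nat \<Rightarrow> (nat \<times> (nat ^ 'n::finite)) set \<Rightarrow> bool" where
  "cell k S \<longleftrightarrow> finite S \<and> fst ` S = {..<k} \<and> card S = k + CARD('n) \<and> determining S"

lemma exponent_vec_add: "exponent_vec (I + J) = exponent_vec I + exponent_vec J"
  by (simp add: exponent_vec_def vec_eq_iff)

lemma exponent_vec_zero [simp]: "exponent_vec 0 = 0"
  by (simp add: exponent_vec_def vec_eq_iff)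

lemma exponent_vec_eq_iff [simp]: "exponent_vec I = exponent_vec J \<longleftrightarrow> I = J"
  by (simp add: exponent_vec_def vec_eq_iff)

lemma affine_form_diff:
  "affine_form z x p - affine_form z' x' p = affine_form (\<lambda>i. z i - z' i) (x - x') p"
  by (simp add: affine_form_def inner_diff_right)

text \<open>
  Linearity: the sum of an affine form over a multiset depends on the total only. All comparisons of
  two multisets with equal totals rest on this.
\<close>

lemma sum_affine_form:
  "(\<Sum>p\<in>#T. affine_form z x p) = (\<Sum>i\<in>#fst (total T). z i) - exponent_vec (snd (total T)) \<bullet> x"
  by (induction T) (auto simp: total_def affine_form_def exponent_vec_add inner_add_left)

lemma determining_unique:
  assumes "determining S" "\<And>p. p \<in> S \<Longrightarrow> affine_form z x p = affine_form z' x' p"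
  shows "x = x'"
proof -
  have "\<forall>p\<in>S. affine_form (\<lambda>i. z i - z' i) (x - x') p = 0"
    using assms(2) by (simp flip: affine_form_diff)
  then have "x - x' = 0"
    using assms(1) unfolding determining_def by blast
  then show ?thesis by simp
qed

lemma sum_mset_mono_eq:
  fixes f g :: "'a \<Rightarrow> real"
  assumes "\<And>p. p \<in># T \<Longrightarrow> f p \<le> g p" "(\<Sum>p\<in>#T. g p) \<le> (\<Sum>p\<in>#T. f p)" "p \<in># T"
  shows "f p = g p"
  using assms
proof (induction T)
  case (add q T)
  have "(\<Sum>p\<in>#T. f p) \<le> (\<Sum>p\<in>#T. g p)"
    by (rule sum_mset_mono) (use add.prems in auto)
  moreover have "f q \<le> g q" using add.prems by auto
  ultimately have "(\<Sum>p\<in>#T. g p) \<le> (\<Sum>p\<in>#T. f p)" "f q = g q"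
    using add.prems(2) by auto
  then show ?case using add by auto
qed simp

text \<open>
  Cells of a regular subdivision have disjoint open cones, and here is the linear programming duality
  behind it. If \<open>T\<close> and \<open>T'\<close> have the same total, then both affine forms have equal sums over \<open>T\<close> and
  \<open>T'\<close>. Since each form is below \<open>h\<close> and meets \<open>h\<close> on its own set, the sums of \<open>h\<close> over \<open>T\<close> and \<open>T'\<close>
  agree as well, and so the second form must meet \<open>h\<close> on \<open>S\<close> too.
\<close>

lemma totals_disjoint:
  assumes le: "\<And>p. p \<in> S \<union> S' \<Longrightarrow> affine_form z x p \<le> h p"
    and le': "\<And>p. p \<in> S \<union> S' \<Longrightarrow> affine_form z' x' p \<le> h p"
    and eq: "\<And>p. p \<in> S \<Longrightarrow> affine_form z x p = h p"
    and eq': "\<And>p. p \<in> S' \<Longrightarrow> affine_form z' x' p = h p"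
    and "determining S" and "x \<noteq> x'"
  shows "totals N S \<inter> totals N S' = {}"
proof (rule ccontr)
  assume "totals N S \<inter> totals N S' \<noteq> {}"
  then obtain T T' where T: "set_mset T = S" and T': "set_mset T' = S'" and TT: "total T = total T'"
    unfolding totals_def by blast
  have same: "(\<Sum>p\<in>#T. affine_form z x p) = (\<Sum>p\<in>#T'. affine_form z x p)" for z x
    by (simp add: sum_affine_form TT)
  have "(\<Sum>p\<in>#T. h p) = (\<Sum>p\<in>#T. affine_form z x p)"
    using eq T by (metis (mono_tags, lifting) image_mset_cong)
  also have "\<dots> \<le> (\<Sum>p\<in>#T'. h p)"
    unfolding same by (rule sum_mset_mono) (use le T' in auto)
  also have "\<dots> = (\<Sum>p\<in>#T'. affine_form z' x' p)"
    using eq' T' by (metis (mono_tags, lifting) image_mset_cong)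
  finally have "(\<Sum>p\<in>#T. h p) \<le> (\<Sum>p\<in>#T. affine_form z' x' p)"
    by (simp add: same)
  then have "affine_form z' x' p = h p" if "p \<in> S" for p
    using sum_mset_mono_eq[of T "affine_form z' x'" h p] le' T that by auto
  then have "x = x'"
    using eq by (intro determining_unique[OF \<open>determining S\<close>, of z x z' x']) simp
  with \<open>x \<noteq> x'\<close> show False ..
qed

lemma independent_prescribe_inner:
  fixes B :: "'a::euclidean_space set"
  assumes "independent B"
  obtains x where "\<And>b. b \<in> B \<Longrightarrow> b \<bullet> x = g b"
proof -
  obtain f where f: "linear f" "\<And>b. b \<in> B \<Longrightarrow> f b = (g b :: real)"
    using linear_independent_extend[OF assms, of g] by auto
  have "b \<bullet> adjoint f 1 = g b" if "b \<in> B" for b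
    using adjoint_works[OF f(1), of b 1] f(2)[OF that] by simp
  then show thesis by (rule that)
qed

lemma span_UNIV_if_no_orthogonal:
  fixes G :: "'a::euclidean_space set"
  assumes "\<And>x. (\<And>g. g \<in> G \<Longrightarrow> g \<bullet> x = 0) \<Longrightarrow> x = 0"
  shows "span G = UNIV"
proof (rule ccontr)
  assume "span G \<noteq> UNIV"
  then obtain a where "a \<noteq> 0" "\<forall>x\<in>span G. a \<bullet> x = 0"
    using span_not_UNIV_orthogonal by blast
  then have "\<And>g. g \<in> G \<Longrightarrow> g \<bullet> a = 0"
    by (simp add: inner_commute span_base)
  with \<open>a \<noteq> 0\<close> assms show False by blast
qed

lemma determining_span:
  assumes "determining S"
  shows "span ((\<lambda>p. exponent_vec (snd p) - exponent_vec (a (fst p))) ` S) = UNIV"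
proof (rule span_UNIV_if_no_orthogonal)
  fix x assume x: "\<And>g. g \<in> (\<lambda>p. exponent_vec (snd p) - exponent_vec (a (fst p))) ` S \<Longrightarrow> g \<bullet> x = 0"
  then have "affine_form (\<lambda>i. exponent_vec (a i) \<bullet> x) x p = 0" if "p \<in> S" for p
    using that x[of "exponent_vec (snd p) - exponent_vec (a (fst p))"]
    by (auto simp: affine_form_def inner_diff_left)
  then show "x = 0" using assms unfolding determining_def by blast
qed

text \<open>
  Relative to a base point \<open>a i\<close> for every index \<open>i\<close>, exactly \<open>n\<close> elements of the cell are left. Their
  exponent differences span \<open>\<real>\<^sup>n\<close> and are therefore a basis, along which inner products with \<open>x\<close> can be
  prescribed; the values \<open>z i\<close> then adjust the base points.
\<close>

lemma cell_interpolation: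
  fixes S :: "(nat \<times> (nat ^ 'n::finite)) set"
  assumes "cell k S"
  obtains z x where "\<And>p. p \<in> S \<Longrightarrow> affine_form z x p = r p"
proof -
  have fin: "finite S" and fst_S: "fst ` S = {..<k}" and card_S: "card S = k + CARD('n)"
    and det: "determining S" using assms by (auto simp: cell_def)
  have "\<forall>i\<in>{..<k}. \<exists>I. (i, I) \<in> S" by (auto simp flip: fst_S)
  then obtain a where a: "\<And>i. i < k \<Longrightarrow> (i, a i) \<in> S" by (metis lessThan_iff)
  define E where "E = S - (\<lambda>i. (i, a i)) ` {..<k}"
  define D where "D = (\<lambda>p::nat \<times> (nat ^ 'n). exponent_vec (snd p) - exponent_vec (a (fst p)))"
  have "card ((\<lambda>i. (i, a i)) ` {..<k}) = k" by (subst card_image) (auto simp: inj_on_def)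
  then have card_E: "card E = CARD('n)" 
    unfolding E_def using card_S a by (subst card_Diff_subset) auto
  have finE: "finite E" using fin E_def by simp
  have "D ` S \<subseteq> insert 0 (D ` E)" unfolding E_def D_def by auto
  moreover have "span (D ` S) = UNIV" unfolding D_def by (rule determining_span[OF det])
  ultimately have spanE: "span (D ` E) = UNIV"
    by (metis span_insert_0 span_mono top.extremum_uniqueI)
  have "DIM(real^'n) \<le> card (D ` E)"
    using span_card_ge_dim[of "D ` E" UNIV] spanE finE by (simp add: dim_UNIV)
  then have card_DE: "card (D ` E) = card E"
    using card_image_le[OF finE, of D] card_E by simp
  then have inj: "inj_on D E" using eq_card_imp_inj_on finE by blast
  have "independent (D ` E)"
    by (rule card_le_dim_spanning[of _ UNIV]) (use spanE finE card_DE card_E in \<open>auto simp: dim_UNIV\<close>)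
  then obtain x where x: "\<And>g. g \<in> D ` E \<Longrightarrow>
      g \<bullet> x = r (fst (inv_into E D g), a (fst (inv_into E D g))) - r (inv_into E D g)"
    using independent_prescribe_inner[where g = "\<lambda>g. r (fst (inv_into E D g), a (fst (inv_into E D g)))
      - r (inv_into E D g)"] by blast
  have "affine_form (\<lambda>i. r (i, a i) + exponent_vec (a i) \<bullet> x) x p = r p" if "p \<in> S" for p
  proof (cases "p \<in> E")
    case True
    then have "D p \<bullet> x = r (fst p, a (fst p)) - r p"
      using x[of "D p"] inv_into_f_f[OF inj True] by simp
    then show ?thesis by (simp add: affine_form_def D_def inner_diff_left)
  next
    case False
    then obtain i where "p = (i, a i)" using \<open>p \<in> S\<close> unfolding E_def by auto
    then show ?thesis by (simp add: affine_form_def)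
  qed
  then show thesis by (rule that)
qed

lemma sum_mset_indicator:
  "(\<Sum>q\<in>#T. if q = p then 1 else 0 :: real) = real (count T p)"
  by (induction T) auto

text \<open>
  The affine form that is 1 at \<open>p\<close> and 0 on the rest of the cell reads off the multiplicity of \<open>p\<close>
  from the total.
\<close>

lemma inj_on_total:
  assumes "cell k S"
  shows "inj_on total {T. set_mset T \<subseteq> S}"
proof (rule inj_onI, clarsimp)
  fix T T' assume sub: "set_mset T \<subseteq> S" "set_mset T' \<subseteq> S" and TT: "total T = total T'"
  show "T = T'"
  proof (rule multiset_eqI)
    fix p
    show "count T p = count T' p"
    proof (cases "p \<in> S")
      case True
      obtain z x where zx: "\<And>q. q \<in> S \<Longrightarrow> affine_form z x q = (if q = p then 1 else 0)"
        using cell_interpolation[OF assms, where r = "\<lambda>q. if q = p then 1 else 0"] by blast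
      have "(\<Sum>q\<in>#U. affine_form z x q) = real (count U p)" if "set_mset U \<subseteq> S" for U
        unfolding sum_mset_indicator[symmetric] using zx that
        by (intro arg_cong[of _ _ sum_mset] image_mset_cong) auto
      from this[OF sub(1)] this[OF sub(2)] show ?thesis by (simp add: sum_affine_form TT)
    next
      case False
      then show ?thesis using sub by (metis count_eq_zero_iff subsetD)
    qed
  qed
qed

section \<open>Lattice simplices at a vertex\<close>

text \<open>
  The local count at a vertex, whose tight monomials are \<open>A\<close>. Two tight exponents \<open>a i \<noteq> b i\<close> of each
  polynomial give a nonzero edge direction \<open>u i\<close>. Let \<open>R\<close> index a basis of the span of all edge
  directions and let \<open>X\<close> be further tight monomials that complete it to a basis of \<open>\<real>\<^sup>n\<close>. Every set
  \<open>F\<close> of indices whose edge directions form a basis of that span yields a cell, consisting of both ends of the edges in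
  \<open>F\<close>, one end of each other edge, and \<open>X\<close>. Besides \<open>R\<close> itself, each \<open>l \<notin> R\<close> can be exchanged for some
  \<open>\<rho> l \<in> R\<close>, because \<open>u l \<noteq> 0\<close>; this makes \<open>k - card R + 1 \<ge> k - n + 1\<close> choices of \<open>F\<close>.
  
  To keep the open cones disjoint, the missing ends are chosen by a height \<open>H\<close> that is 0 except at the
  points \<open>b l\<close> with \<open>l \<notin> R\<close>: every cell consists of points at which some affine form below \<open>H\<close> meets \<open>H\<close>,
  and distinct cells have distinct points \<open>w l\<close>.
\<close>

lemma many_disjoint_cells:
  fixes A :: "(nat \<times> (nat ^ 'n::finite)) set"
  assumes "finite A" and fst_A: "fst ` A \<subseteq> {..<k}" and det: "determining A"
    and two: "\<And>i. i < k \<Longrightarrow> \<exists>I J. I \<noteq> J \<and> (i, I) \<in> A \<and> (i, J) \<in> A"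
  obtains C where "finite C" "k + 1 \<le> card C + CARD('n)"
    "\<And>S. S \<in> C \<Longrightarrow> S \<subseteq> A \<and> cell k S"
    "\<And>S S' N. S \<in> C \<Longrightarrow> S' \<in> C \<Longrightarrow> S \<noteq> S' \<Longrightarrow> totals N S \<inter> totals N S' = {}"
proof -
  obtain a b where ab: "\<And>i. i < k \<Longrightarrow> a i \<noteq> b i" and a_A: "\<And>i. i < k \<Longrightarrow> (i, a i) \<in> A"
    and b_A: "\<And>i. i < k \<Longrightarrow> (i, b i) \<in> A"
    using two by metis
  define D where "D = (\<lambda>p::nat \<times> (nat ^ 'n). exponent_vec (snd p) - exponent_vec (a (fst p)))"
  define u where "u = (\<lambda>i. D (i, b i))"
  have u_def': "u i = exponent_vec (b i) - exponent_vec (a i)" for i by (simp add: u_def D_def)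
  have u_nz: "u i \<noteq> 0" if "i < k" for i using ab[OF that] by (auto simp: u_def')
  obtain B where B: "B \<subseteq> u ` {..<k}" "independent B" "u ` {..<k} \<subseteq> span B"
    using maximal_independent_subset[of "u ` {..<k}"] by metis
  then obtain R where R: "R \<subseteq> {..<k}" "inj_on u R" "B = u ` R" by (auto simp: subset_image_inj)
  have indR: "independent (u ` R)" and spanR: "\<And>i. i < k \<Longrightarrow> u i \<in> span (u ` R)"
    using B R(3) by auto
  have finR: "finite R" using R(1) finite_subset by blast
  have "u ` R \<subseteq> D ` A" using R(1) b_A by (auto simp: u_def)
  then obtain G where G: "u ` R \<subseteq> G" "G \<subseteq> D ` A" "independent G" "D ` A \<subseteq> span G"
    using maximal_independent_subset_extend[OF _ indR] by metis
  have spanG: "span G = UNIV"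
    using determining_span[OF det, of a] span_minimal[OF G(4) subspace_span]
    by (simp add: D_def top.extremum_unique)
  have card_G: "card G = CARD('n)"
    using indep_card_eq_dim_span[OF G(3)] spanG by (simp add: dim_UNIV)
  have finG: "finite G" using G(3) independent_imp_finite by blast
  have "G - u ` R \<subseteq> D ` A" using G(2) by auto
  then obtain X where X: "X \<subseteq> A" "inj_on D X" "G - u ` R = D ` X" by (auto simp: subset_image_inj)
  have finX: "finite X" using X(1) \<open>finite A\<close> finite_subset by blast
  have cards: "card R + card X = CARD('n)"
    using card_Diff_subset[of "u ` R" G] card_mono[OF finG G(1)] finR G(1) X(2,3) R(2) card_G
    by (metis add_diff_inverse_nat card_image finite_imageI linorder_not_less)
  have X_fst: "fst p < k" if "p \<in> X" for p using that X(1) fst_A by auto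
  have X_new: "D p \<notin> span (u ` R)" if "p \<in> X" for p
  proof
    assume "D p \<in> span (u ` R)"
    moreover have "D p \<in> G - u ` R" using X(3) that by blast
    moreover have "u ` R \<subseteq> G - {D p}" using calculation G(1) by blast
    ultimately show False using G(3) unfolding dependent_def
      by (metis DiffD1 span_mono subsetD)
  qed
  have X_not_a: "p \<noteq> (i, a i)" if "p \<in> X" for p i
    using X_new[OF that] span_zero[of "u ` R"] by (auto simp: D_def)
  have X_not_b: "snd p \<noteq> b (fst p)" if "p \<in> X" for p
    using X_new[OF that] spanR[OF X_fst[OF that]] by (cases p) (auto simp: u_def)

  \<comment> \<open>The vectors \<open>xs m\<close> are dual to the basis \<open>u ` R\<close>.\<close>
  have "\<exists>x. \<forall>i\<in>R. u i \<bullet> x = (if i = m then 1 else 0)" for m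
  proof -
    obtain x where "\<And>g. g \<in> u ` R \<Longrightarrow> g \<bullet> x = (if inv_into R u g = m then 1 else 0)"
      using independent_prescribe_inner[OF indR, where g = "\<lambda>g. if inv_into R u g = m then 1 else 0"]
      by blast
    then show ?thesis using inv_into_f_f[OF R(2)] by (intro exI[of _ x]) simp
  qed
  then obtain xs where xs: "\<And>m i. i \<in> R \<Longrightarrow> u i \<bullet> xs m = (if i = m then 1 else 0)"
    by metis
  have expand: "v = (\<Sum>m\<in>R. (v \<bullet> xs m) *\<^sub>R u m)" if "v \<in> span (u ` R)" for v
  proof -
    have lin: "linear (\<lambda>v. v - (\<Sum>m\<in>R. (v \<bullet> xs m) *\<^sub>R u m))"
      by (intro linear_compose_sub linear_compose_sum linear_ident ballI)
        (auto intro!: linearI simp: inner_add_left scaleR_add_left)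
    have "v - (\<Sum>m\<in>R. (v \<bullet> xs m) *\<^sub>R u m) = 0"
    proof (rule linear_eq_0_on_span[OF lin _ that])
      fix g assume "g \<in> u ` R"
      then obtain i where i: "i \<in> R" "g = u i" by blast
      then have "(\<Sum>m\<in>R. (g \<bullet> xs m) *\<^sub>R u m) = (\<Sum>m\<in>R. if m = i then u m else 0)"
        by (intro sum.cong) (auto simp: xs)
      then show "g - (\<Sum>m\<in>R. (g \<bullet> xs m) *\<^sub>R u m) = 0"
        using i finR by simp
    qed
    then show ?thesis by simp
  qed
  have "\<exists>m\<in>R. u l \<bullet> xs m \<noteq> 0" if "l < k" for l
  proof (rule ccontr)
    assume "\<not> ?thesis"
    then have "u l = 0" using expand[OF spanR[OF that]] by simp
    then show False using u_nz[OF that] by simp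
  qed
  then obtain \<rho> where \<rho>: "\<And>l. l < k \<Longrightarrow> \<rho> l \<in> R" "\<And>l. l < k \<Longrightarrow> u l \<bullet> xs (\<rho> l) \<noteq> 0"
    by metis

  \<comment> \<open>The cells are indexed by the \<open>l < k\<close> outside \<open>R\<close>, together with \<open>l = k\<close> for the choice \<open>F = R\<close>.
    The point \<open>y l\<close> solves \<open>h i + u i \<bullet> y l = 0\<close> for all \<open>i \<in> F l\<close>; the factors \<open>l + 1\<close> in \<open>h\<close> are there
    to make these points distinct, also when \<open>\<rho>\<close> takes the same value twice.\<close>
  define L where "L = {..k} - R"
  define y where "y = (\<lambda>l. if l = k then 0 else - real (l + 1) *\<^sub>R xs (\<rho> l))"
  define h where "h = (\<lambda>i. if i \<in> R then 0 else real (i + 1) * (u i \<bullet> xs (\<rho> i)))"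
  define F where "F = (\<lambda>l. if l = k then R else insert l (R - {\<rho> l}))"
  have kR: "k \<notin> R" using R(1) by auto
  have uy: "u m \<bullet> y l = (if l \<noteq> k \<and> m = \<rho> l then - real (l + 1) else 0)" if "m \<in> R" for m l
    using xs[OF that, of "\<rho> l"] by (auto simp: y_def)
  have F_sub: "F l \<subseteq> {..<k}" if "l \<in> L" for l
    using that R(1) by (auto simp: F_def L_def)
  have F_card: "card (F l) = card R" if "l \<in> L" for l
  proof (cases "l = k")
    case False
    then have "l < k" "l \<notin> R" using that by (auto simp: L_def)
    then show ?thesis
      using card_Suc_Diff1[OF finR \<rho>(1)[of l]] finR False by (simp add: F_def)
  qed (simp add: F_def)
  have F_zero: "h i + u i \<bullet> y l = 0" if "l \<in> L" "i \<in> F l" for l i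
    using that uy[of i l] by (cases "l = k") (auto simp: F_def h_def y_def L_def algebra_simps)

  \<comment> \<open>Inner products with edge directions leave freedom in the directions complementary to their span.
    It is used to bring every element of \<open>X\<close> to height 0, whichever end of its edge is chosen.\<close>
  have "\<exists>w. (\<forall>i<k. u i \<bullet> w = u i \<bullet> y l) \<and> (\<forall>p\<in>X. D p \<bullet> w = min 0 (h (fst p) + u (fst p) \<bullet> y l))" for l
  proof -
    define g where "g = (\<lambda>v. if v \<in> u ` R then v \<bullet> y l
      else min 0 (h (fst (inv_into X D v)) + u (fst (inv_into X D v)) \<bullet> y l))"
    obtain w where w: "\<And>v. v \<in> G \<Longrightarrow> v \<bullet> w = g v"
      using independent_prescribe_inner[OF G(3), of g] by blast
    have "orthogonal (w - y l) v" if "v \<in> u ` R" for v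
      using w[of v] that G(1) by (auto simp: g_def orthogonal_def inner_diff_left inner_diff_right inner_commute)
    then have "orthogonal (w - y l) (u i)" if "i < k" for i
      using orthogonal_to_span[OF spanR[OF that]] by blast
    then have "\<forall>i<k. u i \<bullet> w = u i \<bullet> y l"
      by (simp add: orthogonal_def inner_diff_left inner_diff_right inner_commute)
    moreover have "D p \<bullet> w = min 0 (h (fst p) + u (fst p) \<bullet> y l)" if "p \<in> X" for p
    proof -
      have "D p \<in> G" "D p \<notin> u ` R" using X(3) that by blast+
      then show ?thesis using w[of "D p"] inv_into_f_f[OF X(2) that] by (simp add: g_def)
    qed
    ultimately show ?thesis by blast
  qed
  then obtain w where w: "\<And>l i. i < k \<Longrightarrow> u i \<bullet> w l = u i \<bullet> y l"
    and wX: "\<And>l p. p \<in> X \<Longrightarrow> D p \<bullet> w l = min 0 (h (fst p) + u (fst p) \<bullet> y l)"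
    by metis
  define z where "z = (\<lambda>l i. exponent_vec (a i) \<bullet> w l + min 0 (h i + u i \<bullet> y l))"
  define H where "H = (\<lambda>p::nat \<times> (nat ^ 'n). if snd p = b (fst p) then h (fst p) else 0)"
  define c where "c = (\<lambda>l i. if 0 \<le> h i + u i \<bullet> y l then a i else b i)"
  define S where "S = (\<lambda>l. (\<lambda>i. (i, c l i)) ` {..<k} \<union> (\<lambda>i. (i, b i)) ` F l \<union> X)"

  have form_a: "affine_form (z l) (w l) (i, a i) = min 0 (h i + u i \<bullet> y l)" for l i
    by (simp add: affine_form_def z_def)
  have form_b: "affine_form (z l) (w l) (i, b i) = min 0 (h i + u i \<bullet> y l) - u i \<bullet> y l" if "i < k" for l i
    using w[OF that, of l] by (simp add: affine_form_def z_def u_def' inner_diff_left)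
  have form_X: "affine_form (z l) (w l) p = 0" if "p \<in> X" for l p
    using wX[OF that, of l] by (simp add: affine_form_def z_def D_def inner_diff_left)
  have H_a: "H (i, a i) = 0" if "i < k" for i using ab[OF that] by (simp add: H_def)
  have H_b: "H (i, b i) = h i" for i by (simp add: H_def)
  have H_X: "H p = 0" if "p \<in> X" for p using X_not_b[OF that] by (simp add: H_def)
  have S_cases: "(\<exists>i<k. p = (i, a i)) \<or> (\<exists>i<k. p = (i, b i)) \<or> p \<in> X" if "p \<in> S l" "l \<in> L" for p l
    using that F_sub[OF that(2)] by (auto simp: S_def c_def)
  have below: "affine_form (z l') (w l') p \<le> H p" if "p \<in> S l" "l \<in> L" for l l' p
    using S_cases[OF that] by (auto simp: form_a form_b form_X H_a H_b H_X)
  have on: "affine_form (z l) (w l) p = H p" if "p \<in> S l" "l \<in> L" for l p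
  proof -
    consider i where "i < k" "p = (i, c l i)" | i where "i \<in> F l" "p = (i, b i)" | "p \<in> X"
      using \<open>p \<in> S l\<close> unfolding S_def by blast
    then show ?thesis
    proof cases
      case 1
      then show ?thesis by (auto simp: c_def form_a form_b H_a H_b min_def)
    next
      case 2
      then show ?thesis using F_sub[OF \<open>l \<in> L\<close>] F_zero[OF \<open>l \<in> L\<close>, of i] form_b[of i l]
        by (auto simp: H_b)
    qed (simp add: form_X H_X)
  qed
  have S_det: "determining (S l)" if "l \<in> L" for l
    unfolding determining_def
  proof (intro allI impI)
    fix \<zeta> x assume zero: "\<forall>p\<in>S l. affine_form \<zeta> x p = 0"
    have c_zero: "\<zeta> i = exponent_vec (c l i) \<bullet> x" if "i < k" for i
      using bspec[OF zero, of "(i, c l i)"] that by (auto simp: S_def affine_form_def)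
    have F_orth: "u i \<bullet> x = 0" if "i \<in> F l" for i
    proof -
      have "c l i = a i" using F_zero[OF \<open>l \<in> L\<close> that] by (simp add: c_def)
      moreover have "affine_form \<zeta> x (i, b i) = 0" using zero that by (auto simp: S_def)
      moreover have "i < k" using F_sub[OF \<open>l \<in> L\<close>] that by auto
      ultimately show ?thesis using c_zero by (simp add: affine_form_def u_def' inner_diff_left)
    qed
    have R_orth: "u i \<bullet> x = 0" if "i \<in> R" for i
    proof (cases "i \<in> F l")
      case False
      then have l: "l \<noteq> k" "i = \<rho> l" using that by (auto simp: F_def split: if_splits)
      then have "l < k" using \<open>l \<in> L\<close> by (auto simp: L_def)
      have "0 = u l \<bullet> x" using F_orth[of l] l by (simp add: F_def)
      also have "\<dots> = (\<Sum>m\<in>R. (u l \<bullet> xs m) * (u m \<bullet> x))"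
        by (subst expand[OF spanR[OF \<open>l < k\<close>]]) (simp add: inner_sum_left)
      also have "\<dots> = (\<Sum>m\<in>R. if m = i then (u l \<bullet> xs m) * (u m \<bullet> x) else 0)"
        by (intro sum.cong) (auto intro!: F_orth simp: F_def l)
      also have "\<dots> = (u l \<bullet> xs i) * (u i \<bullet> x)" using finR that by simp
      finally show ?thesis using \<rho>(2)[OF \<open>l < k\<close>] l by simp
    qed (rule F_orth)
    have u_orth: "u i \<bullet> x = 0" if "i < k" for i
    proof -
      have "orthogonal x (u i)"
      proof (rule orthogonal_to_span[OF spanR[OF that]])
        show "orthogonal x v" if "v \<in> u ` R" for v
          using that R_orth by (subst orthogonal_commute) (auto simp: orthogonal_def)
      qed
      then show ?thesis by (simp add: orthogonal_def inner_commute)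
    qed
    have z_a: "\<zeta> i = exponent_vec (a i) \<bullet> x" if "i < k" for i
      using c_zero[OF that] u_orth[OF that] by (auto simp: c_def u_def' inner_diff_left split: if_splits)
    have X_orth: "D p \<bullet> x = 0" if "p \<in> X" for p
      using bspec[OF zero, of p] z_a[OF X_fst[OF that]] that
      by (auto simp: S_def affine_form_def D_def inner_diff_left)
    have "g \<bullet> x = 0" if "g \<in> G" for g
    proof (cases "g \<in> u ` R")
      case False
      then have "g \<in> D ` X" using that X(3) by blast
      then show ?thesis using X_orth by blast
    qed (use R_orth in blast)
    then have "orthogonal x g" if "g \<in> G" for g
      using that by (subst orthogonal_commute) (auto simp: orthogonal_def)
    then have "orthogonal x x"
      by (intro orthogonal_to_span[of x G]) (auto simp: spanG)
    then show "x = 0" by (simp add: orthogonal_def)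
  qed
  have S_cell: "cell k (S l)" if "l \<in> L" for l
  proof -
    have "card ((\<lambda>i. (i, c l i)) ` {..<k}) = k" by (subst card_image) (auto simp: inj_on_def)
    moreover have "card ((\<lambda>i. (i, b i)) ` F l) = card R"
      using F_card[OF that] by (subst card_image) (auto simp: inj_on_def)
    moreover have "(\<lambda>i. (i, c l i)) ` {..<k} \<inter> (\<lambda>i. (i, b i)) ` F l = {}"
      using F_zero[OF that] ab by (auto simp: c_def)
    moreover have "((\<lambda>i. (i, c l i)) ` {..<k} \<union> (\<lambda>i. (i, b i)) ` F l) \<inter> X = {}"
      using X_not_a X_not_b by (fastforce simp: c_def)
    moreover have "finite (F l)" using F_sub[OF that] finite_subset by blast
    ultimately have "card (S l) = k + CARD('n)"
      unfolding S_def using finX cards by (simp add: card_Un_disjoint)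
    moreover have "fst ` S l = {..<k}"
      unfolding S_def image_Un image_image using F_sub[OF that] X_fst by auto
    moreover have "finite (S l)" unfolding S_def using \<open>finite (F l)\<close> finX by simp
    ultimately show ?thesis using S_det[OF that] by (simp add: cell_def)
  qed
  \<comment> \<open>If \<open>l \<noteq> k\<close>, then \<open>u (\<rho> l) \<bullet> y l = - (l + 1)\<close>, while \<open>y l\<close> is orthogonal to all other
    \<open>u m\<close> with \<open>m \<in> R\<close>, and \<open>y k = 0\<close>.\<close>
  have w_inj: "w l \<noteq> w l'" if "l \<in> L" "l' \<in> L" "l \<noteq> l'" for l l'
  proof
    assume "w l = w l'"
    then have eq: "u m \<bullet> y l = u m \<bullet> y l'" if "m \<in> R" for m
      using w[of m l] w[of m l'] that R(1) by auto
    have *: "l \<le> k" "l' \<le> k" using that by (auto simp: L_def)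
    have False if "l \<noteq> k" "l \<noteq> l'" "l \<le> k" "\<And>m. m \<in> R \<Longrightarrow> u m \<bullet> y l = u m \<bullet> y l'" for l l'
      using that(1,2,3) that(4)[of "\<rho> l"] \<rho>(1)[of l] by (auto simp: uy split: if_splits)
    then show False using * eq that(3) by metis
  qed
  have disj: "totals N (S l) \<inter> totals N (S l') = {}" if "l \<in> L" "l' \<in> L" "l \<noteq> l'" for l l' N
    by (rule totals_disjoint[of _ _ "z l" "w l" H "z l'" "w l'"])
      (use that below on S_det w_inj in auto)
  have S_inj: "inj_on S L"
  proof (rule inj_onI, rule ccontr)
    fix l l' assume l: "l \<in> L" "l' \<in> L" "S l = S l'" "l \<noteq> l'"
    have "w l = w l'"
      by (rule determining_unique[OF S_det[OF l(1)], of "z l" _ "z l'"]) (use on l in auto)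
    then show False using w_inj l by blast
  qed
  show thesis
  proof (rule that[of "S ` L"])
    show "finite (S ` L)" by (simp add: L_def)
    have "card L = k + 1 - card R"
      unfolding L_def using finR R(1) by (subst card_Diff_subset) auto
    then show "k + 1 \<le> card (S ` L) + CARD('n)"
      using cards by (simp add: card_image[OF S_inj])
    show "T \<subseteq> A \<and> cell k T" if "T \<in> S ` L" for T
      using that S_cell S_cases a_A b_A X(1) by blast
    show "totals N T \<inter> totals N T' = {}" if "T \<in> S ` L" "T' \<in> S ` L" "T \<noteq> T'" for T T' N
      using that disj by blast
  qed
qed

section \<open>Counting lattice points\<close>

text \<open>
  Taking away one copy of every element of the cell leaves an arbitrary multiset of size \<open>N\<close>.
\<close>

lemma card_totals:
  fixes S :: "(nat \<times> (nat ^ 'n::finite)) set"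
  assumes "cell k S"
  shows "card (totals (k + CARD('n) + N) S) = (k + CARD('n) + N - 1) choose N"
proof -
  have fin: "finite S" and card_S: "card S = k + CARD('n)" using assms by (auto simp: cell_def)
  have "card (totals (k + CARD('n) + N) S) = card {T. set_mset T = S \<and> size T = k + CARD('n) + N}"
    unfolding totals_def
    by (rule card_image, rule inj_on_subset[OF inj_on_total[OF assms]]) auto
  also have "{T. set_mset T = S \<and> size T = k + CARD('n) + N} = (\<lambda>T. mset_set S + T) ` multisets_of_size S N"
  proof (intro equalityI subsetI)
    fix T assume T: "T \<in> {T. set_mset T = S \<and> size T = k + CARD('n) + N}"
    then have "mset_set S \<subseteq># T" using mset_set_set_mset_msubset[of T] by simp
    then have "T = mset_set S + (T - mset_set S)" "size (T - mset_set S) = N"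
      using T card_S by (auto simp: size_Diff_submset)
    moreover have "set_mset (T - mset_set S) \<subseteq> S" using T by (auto dest: in_diffD)
    ultimately show "T \<in> (\<lambda>T. mset_set S + T) ` multisets_of_size S N"
      unfolding multisets_of_size_def by blast
  qed (use fin card_S in \<open>auto simp: multisets_of_size_def\<close>)
  also have "card \<dots> = card (multisets_of_size S N)"
    by (rule card_image) (auto simp: inj_on_def)
  also have "\<dots> = (k + CARD('n) + N - 1) choose N"
    using card_multisets_of_size[OF fin] by (simp add: card_S)
  finally show ?thesis .
qed

text \<open>
  A slack element \<open>None\<close> fills the vector up to a multiset of size exactly \<open>m\<close> over \<open>n + 1\<close> elements.
\<close>

lemma card_bounded_sum_vectors:
  fixes m :: nat
  defines "Y \<equiv> {y :: nat ^ 'n::finite. (\<Sum>j\<in>UNIV. y $ j) \<le> m}"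
  shows "finite Y" "card Y \<le> (CARD('n) + m) choose m"
proof -
  define \<phi> where "\<phi> = (\<lambda>y :: nat ^ 'n. (\<Sum>j\<in>UNIV. replicate_mset (y $ j) (Some j))
      + replicate_mset (m - (\<Sum>j\<in>UNIV. y $ j)) None)"
  have count: "count (\<phi> y) (Some i) = y $ i" for y i
    by (simp add: \<phi>_def count_sum sum.delta)
  have inj: "inj_on \<phi> Y"
    by (rule inj_onI) (metis count vec_eq_iff)
  have sub: "\<phi> ` Y \<subseteq> multisets_of_size UNIV m"
    by (auto simp: multisets_of_size_def \<phi>_def Y_def size_multiset_sum)
  have fin: "finite (multisets_of_size (UNIV :: 'n option set) m)" by auto
  show "finite Y" using finite_imageD[OF finite_subset[OF sub fin] inj] .
  have "card Y = card (\<phi> ` Y)" by (simp add: card_image[OF inj])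
  also have "\<dots> \<le> card (multisets_of_size (UNIV :: 'n option set) m)" by (rule card_mono[OF fin sub])
  also have "\<dots> = (CARD('n) + m) choose m"
    by (subst card_multisets_of_size) (simp_all add: card_UNIV_option)
  finally show "card Y \<le> (CARD('n) + m) choose m" .
qed

lemma totals_subset:
  assumes "fst ` S \<subseteq> {..<k}" "\<And>p. p \<in> S \<Longrightarrow> monomial_degree (snd p) \<le> d"
  shows "totals N S \<subseteq> multisets_of_size {..<k} N \<times> {y. (\<Sum>j\<in>UNIV. y $ j) \<le> d * N}"
proof -
  have "(\<Sum>j\<in>UNIV. snd (total T) $ j) \<le> d * size T" if "set_mset T \<subseteq> S" for T
    using that
  proof (induction T)
    case empty
    then show ?case by (simp add: total_def)
  next
    case (add p T)
    then show ?case using assms(2)[of p]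
      by (simp add: total_def sum.distrib monomial_degree_def)
  qed
  then show ?thesis using assms(1) by (force simp: totals_def total_def multisets_of_size_def)
qed

text \<open>
  All open cones share the lattice points of the dilated Cayley polytope of \<open>k\<close> copies of the simplex
  of size \<open>d\<close>. The height \<open>M\<close> exceeds \<open>N\<close> by the size of a cell, as in \<open>card_totals\<close>.
\<close>

lemma card_disjoint_cells_choose:
  fixes C :: "(nat \<times> (nat ^ 'n::finite)) set set"
  assumes "finite C" and cell: "\<And>S. S \<in> C \<Longrightarrow> cell k S"
    and deg: "\<And>S p. S \<in> C \<Longrightarrow> p \<in> S \<Longrightarrow> monomial_degree (snd p) \<le> d"
    and disj: "\<And>S S' N. S \<in> C \<Longrightarrow> S' \<in> C \<Longrightarrow> S \<noteq> S' \<Longrightarrow> totals N S \<inter> totals N S' = {}"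
    and M: "M = k + CARD('n) + N"
  shows "card C * ((k + CARD('n) + N - 1) choose N)
    \<le> ((k + M - 1) choose M) * ((CARD('n) + d * M) choose (d * M))"
proof -
  let ?Q = "multisets_of_size {..<k} M \<times> {y :: nat ^ 'n. (\<Sum>j\<in>UNIV. y $ j) \<le> d * M}"
  have finQ: "finite ?Q" by (intro finite_cartesian_product card_bounded_sum_vectors) auto
  have sub: "totals M S \<subseteq> ?Q" if "S \<in> C" for S
    using cell[OF that] deg[OF that] by (intro totals_subset) (auto simp: cell_def)
  have "card C * ((k + CARD('n) + N - 1) choose N) = (\<Sum>S\<in>C. card (totals M S))"
    using card_totals[OF cell] M by simp
  also have "\<dots> = card (\<Union>S\<in>C. totals M S)"
    by (rule card_UN_disjoint[symmetric])
      (use \<open>finite C\<close> disj finite_subset[OF sub finQ] in auto)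
  also have "\<dots> \<le> card ?Q" by (rule card_mono[OF finQ]) (use sub in blast)
  also have "\<dots> \<le> ((k + M - 1) choose M) * ((CARD('n) + d * M) choose (d * M))"
    unfolding card_cartesian_product
    using card_bounded_sum_vectors(2)[where 'n = 'n and m = "d * M"]
    by (simp add: card_multisets_of_size)
  finally show ?thesis .
qed

lemma power_le_fact_mult_choose: "N ^ q \<le> fact q * ((q + N) choose q)"
proof (induction q)
  case (Suc q)
  have "N ^ Suc q \<le> Suc (q + N) * (fact q * ((q + N) choose q))"
    using mult_mono[OF _ Suc.IH, of N "Suc (q + N)"] by simp
  also have "\<dots> = fact (Suc q) * ((Suc q + N) choose Suc q)"
    using Suc_times_binomial_eq[of "q + N" q] by (simp add: algebra_simps)
  finally show ?case .
qed simp

lemma fact_mult_choose_le_power: "fact q * ((q + N) choose q) \<le> (q + N) ^ q"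
  using binomial_fact_pow[of "q + N" q] by (simp add: mult.commute)

text \<open>
  In the inequality of the previous lemma both sides grow like \<open>N\<close> to the power \<open>k + n - 1\<close>. Comparing leading
  coefficients says that the total normalized volume \<open>d\<^sup>n (k + n - 1 choose n)\<close> bounds the number of lattice simplices with
  disjoint interiors.
\<close>

lemma card_disjoint_cells_le:
  fixes C :: "(nat \<times> (nat ^ 'n::finite)) set set"
  assumes "finite C" and cell: "\<And>S. S \<in> C \<Longrightarrow> cell k S"
    and deg: "\<And>S p. S \<in> C \<Longrightarrow> p \<in> S \<Longrightarrow> monomial_degree (snd p) \<le> d"
    and disj: "\<And>S S' N. S \<in> C \<Longrightarrow> S' \<in> C \<Longrightarrow> S \<noteq> S' \<Longrightarrow> totals N S \<inter> totals N S' = {}"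
    and "0 < k"
  shows "real (card C) \<le> real d ^ CARD('n) * real ((k + CARD('n) - 1) choose CARD('n))"
proof -
  define n where "n = CARD('n)"
  define q where "q = k + n - 1"
  have q: "q = (k - 1) + n" using \<open>0 < k\<close> by (simp add: q_def)
  have ineq: "real (card C) / fact q \<le>
      (1 + real (2 * k + n) / real N) ^ (k - 1) / fact (k - 1)
      * ((real d + real (n + d * (k + n)) / real N) ^ n / fact n)" if "N > 0" for N
  proof -
    define M where "M = k + n + N"
    have choose: "card C * ((q + N) choose N) \<le> ((k - 1 + M) choose M) * ((n + d * M) choose (d * M))"
      using card_disjoint_cells_choose[OF assms(1) cell deg disj M_def[unfolded n_def]] \<open>0 < k\<close>
      by (simp add: n_def q_def)
    have sym: "(r + L) choose L = (r + L) choose r" for r L :: nat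
      using binomial_symmetric[of L "r + L"] by simp
    have "card C * ((q + N) choose q) \<le> ((k - 1 + M) choose (k - 1)) * ((n + d * M) choose n)"
      using choose by (simp only: sym[of q N] sym[of "k - 1" M] sym[of n "d * M"])
    then have le: "real (card C) * real ((q + N) choose q)
        \<le> real ((k - 1 + M) choose (k - 1)) * real ((n + d * M) choose n)"
      by (metis of_nat_le_iff of_nat_mult)
    have lower: "real N ^ q / fact q \<le> real ((q + N) choose q)"
      using of_nat_mono[OF power_le_fact_mult_choose[of N q], where 'a = real]
      by (simp add: field_simps)
    have upper: "real ((r + L) choose r) \<le> real (r + L) ^ r / fact r" for r L
      using of_nat_mono[OF fact_mult_choose_le_power[of r L], where 'a = real]
      by (simp add: field_simps)
    have "real (card C) * (real N ^ q / fact q) \<le> real (card C) * real ((q + N) choose q)"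
      by (rule mult_left_mono[OF lower]) simp
    also note le
    also have "real ((k - 1 + M) choose (k - 1)) * real ((n + d * M) choose n)
        \<le> (real (k - 1 + M) ^ (k - 1) / fact (k - 1)) * (real (n + d * M) ^ n / fact n)"
      by (intro mult_mono upper) auto
    also have "\<dots> \<le> (real (2 * k + n + N) ^ (k - 1) / fact (k - 1)) * (real (n + d * M) ^ n / fact n)"
      by (intro mult_right_mono divide_right_mono power_mono) (auto simp: M_def)
    finally have "real (card C) / fact q * real N ^ q \<le>
      real (2 * k + n + N) ^ (k - 1) / fact (k - 1) * (real (n + d * M) ^ n / fact n)"
      by simp
    then have "real (card C) / fact q \<le>
      real (2 * k + n + N) ^ (k - 1) / fact (k - 1) * (real (n + d * M) ^ n / fact n) / real N ^ q"
      using that by (subst pos_le_divide_eq) auto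
    also have "\<dots> = (real (2 * k + n + N) / real N) ^ (k - 1) / fact (k - 1)
        * ((real (n + d * M) / real N) ^ n / fact n)"
      by (simp add: q power_add power_divide)
    also have "real (2 * k + n + N) / real N = 1 + real (2 * k + n) / real N"
      using that by (simp add: field_simps)
    also have "real (n + d * M) / real N = real d + real (n + d * (k + n)) / real N"
      using that by (simp add: field_simps M_def)
    finally show ?thesis .
  qed
  have inv: "(\<lambda>N. c / real N) \<longlonglongrightarrow> 0" for c :: real
    by (rule lim_const_over_n)
  have "(\<lambda>N. (1 + real (2 * k + n) / real N) ^ (k - 1) / fact (k - 1)
      * ((real d + real (n + d * (k + n)) / real N) ^ n / fact n))
    \<longlonglongrightarrow> (1 + 0) ^ (k - 1) / fact (k - 1) * ((real d + 0) ^ n / fact n)"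
    by (intro tendsto_intros inv) auto
  then have "real (card C) / fact q \<le> (1 + 0) ^ (k - 1) / fact (k - 1) * ((real d + 0) ^ n / fact n)"
    by (rule LIMSEQ_le_const) (use ineq in \<open>auto intro!: exI[of _ 1]\<close>)
  then have "real (card C) \<le> real d ^ n * (fact q / (fact n * fact (k - 1)))"
    by (simp add: field_simps)
  also have "fact q / (fact n * fact (k - 1)) = real (q choose n)"
    by (subst binomial_fact) (auto simp: q)
  finally show ?thesis by (simp add: q_def n_def)
qed

section \<open>Vertices of tropical prevarieties\<close>

definition tight_monomials ::
    "nat \<Rightarrow> (nat \<Rightarrow> 'n::finite tropical_poly) \<Rightarrow> real ^ 'n \<Rightarrow> (nat \<times> (nat ^ 'n)) set" where
  "tight_monomials k f x =
    {(i, I). i < k \<and> I \<in> dom (f i) \<and> monomial_value (f i) I x = tropical_value (f i) x}"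

lemma monomial_value_inner: "monomial_value f I x = the (f I) + exponent_vec I \<bullet> x"
  by (simp add: monomial_value_def exponent_vec_def inner_vec_def)

lemma tropical_value_le:
  "tropical_polynomial f \<Longrightarrow> I \<in> dom f \<Longrightarrow> tropical_value f x \<le> monomial_value f I x"
  by (simp add: tropical_polynomial_def tropical_value_def)

lemma tropical_prevariety_iff:
  "x \<in> tropical_prevariety k f \<longleftrightarrow>
    (\<forall>i<k. \<exists>I J. I \<noteq> J \<and> (i, I) \<in> tight_monomials k f x \<and> (i, J) \<in> tight_monomials k f x)"
proof -
  have "tropical_zero (f i) x \<longleftrightarrow>
      (\<exists>I J. I \<noteq> J \<and> (i, I) \<in> tight_monomials k f x \<and> (i, J) \<in> tight_monomials k f x)" if "i < k" for i
    using that unfolding tropical_zero_def tight_monomials_def mem_Collect_eq case_prod_conv by blast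
  then show ?thesis by (simp add: tropical_prevariety_def)
qed

lemma monomial_degree_zero_iff: "monomial_degree I = 0 \<longleftrightarrow> I = 0"
  by (simp add: monomial_degree_def vec_eq_iff)

lemma monomial_degree_le:
  "tropical_polynomial f \<Longrightarrow> I \<in> dom f \<Longrightarrow> monomial_degree I \<le> tropical_degree f"
  by (simp add: tropical_polynomial_def tropical_degree_def)

text \<open>
  A tropical zero needs two monomials, so the degree is positive, and finite coefficients then supply
  the constant and all linear monomials.
\<close>

lemma tropical_zero_imp_linear_monomials:
  fixes f :: "'n::finite tropical_poly"
  assumes "tropical_polynomial f" "finite_coefficients f" "tropical_zero f x"
  shows "0 \<in> dom f" "axis j 1 \<in> dom f"
proof -
  obtain I J where "I \<in> dom f" "J \<in> dom f" "I \<noteq> J"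
    using assms(3) unfolding tropical_zero_def by blast
  then have "0 < tropical_degree f"
    using monomial_degree_le[OF assms(1)] monomial_degree_zero_iff
    by (metis bot_nat_0.extremum_uniqueI not_gr_zero)
  moreover have "monomial_degree (axis j 1 :: nat ^ 'n) = 1"
    by (simp add: monomial_degree_def axis_def if_distrib cong: if_cong)
  moreover have "monomial_degree (0 :: nat ^ 'n) = 0" by (simp add: monomial_degree_zero_iff)
  ultimately show "0 \<in> dom f" "axis j 1 \<in> dom f"
    using assms(2) unfolding finite_coefficients_def by simp_all
qed

lemma finite_tight_monomials:
  assumes "\<And>i. i < k \<Longrightarrow> tropical_polynomial (f i)"
  shows "finite (Sigma {..<k} (\<lambda>i. dom (f i)))"
    "tight_monomials k f x \<subseteq> Sigma {..<k} (\<lambda>i. dom (f i))"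
  using assms by (auto simp: tropical_polynomial_def tight_monomials_def)

lemma affine_form_tropical_le:
  assumes "\<And>i. i < k \<Longrightarrow> tropical_polynomial (f i)" "p \<in> Sigma {..<k} (\<lambda>i. dom (f i))"
  shows "affine_form (\<lambda>i. tropical_value (f i) x) x p \<le> the (f (fst p) (snd p))"
proof -
  have "fst p < k" "snd p \<in> dom (f (fst p))" using assms(2) by auto
  from tropical_value_le[OF assms(1)[OF this(1)] this(2), of x] show ?thesis
    by (simp add: affine_form_def monomial_value_inner)
qed

lemma affine_form_tropical_eq:
  assumes "p \<in> tight_monomials k f x"
  shows "affine_form (\<lambda>i. tropical_value (f i) x) x p = the (f (fst p) (snd p))"
  using assms by (auto simp: tight_monomials_def affine_form_def monomial_value_inner)

text \<open>
  Along a direction \<open>w\<close> on which the monomials tight at \<open>v\<close> of each polynomial \<open>i\<close> change at the common rate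
  \<open>z i\<close>, the polynomials stay linear as long as no other monomial falls below; the assumption \<open>le\<close> says
  that this is still so at parameter \<open>t\<close>.
\<close>

lemma tight_monomials_along_line:
  assumes poly: "\<And>i. i < k \<Longrightarrow> tropical_polynomial (f i)"
    and v: "v \<in> tropical_prevariety k f"
    and w: "\<And>p. p \<in> tight_monomials k f v \<Longrightarrow> affine_form z w p = 0"
    and le: "\<And>p. p \<in> Sigma {..<k} (\<lambda>i. dom (f i)) \<Longrightarrow>
      affine_form (\<lambda>i. tropical_value (f i) v) v p + t * affine_form z w p \<le> the (f (fst p) (snd p))"
  shows "tight_monomials k f (v + t *\<^sub>R w) = {p \<in> Sigma {..<k} (\<lambda>i. dom (f i)).
      affine_form (\<lambda>i. tropical_value (f i) v) v p + t * affine_form z w p = the (f (fst p) (snd p))}"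
proof -
  have gap: "monomial_value (f i) I (v + t *\<^sub>R w) - (tropical_value (f i) v + t * z i)
      = the (f i I) - (affine_form (\<lambda>i. tropical_value (f i) v) v (i, I) + t * affine_form z w (i, I))" for i I
    by (simp add: monomial_value_inner affine_form_def inner_add_right algebra_simps)
  have val: "tropical_value (f i) (v + t *\<^sub>R w) = tropical_value (f i) v + t * z i" if "i < k" for i
    unfolding tropical_value_def[of "f i" "v + t *\<^sub>R w"]
  proof (rule Min_eqI)
    show "finite ((\<lambda>I. monomial_value (f i) I (v + t *\<^sub>R w)) ` dom (f i))"
      using poly[OF that] by (simp add: tropical_polynomial_def)
    show "tropical_value (f i) v + t * z i \<le> y"
      if "y \<in> (\<lambda>I. monomial_value (f i) I (v + t *\<^sub>R w)) ` dom (f i)" for y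
    proof -
      from that obtain I where "I \<in> dom (f i)" "y = monomial_value (f i) I (v + t *\<^sub>R w)" by blast
      then show ?thesis using gap[of i I] le[of "(i, I)"] \<open>i < k\<close> by auto
    qed
    obtain I where I: "(i, I) \<in> tight_monomials k f v"
      using v \<open>i < k\<close> unfolding tropical_prevariety_iff by blast
    then have "I \<in> dom (f i)" "monomial_value (f i) I (v + t *\<^sub>R w) = tropical_value (f i) v + t * z i"
      using gap[of i I] w[OF I] affine_form_tropical_eq[OF I] by (auto simp: tight_monomials_def)
    then show "tropical_value (f i) v + t * z i \<in> (\<lambda>I. monomial_value (f i) I (v + t *\<^sub>R w)) ` dom (f i)"
      by (metis imageI)
  qed
  have "monomial_value (f i) I (v + t *\<^sub>R w) = tropical_value (f i) (v + t *\<^sub>R w) \<longleftrightarrow>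
      affine_form (\<lambda>i. tropical_value (f i) v) v (i, I) + t * affine_form z w (i, I) = the (f i I)"
    if "i < k" for i I
    unfolding val[OF that] using gap[of i I] by linarith
  then show ?thesis unfolding tight_monomials_def by auto
qed

text \<open>
  A point of the component with the largest number of tight monomials is a vertex. Otherwise one can
  move in a direction \<open>w \<noteq> 0\<close> that keeps all tight monomials tight, until a new monomial becomes tight.
  That this happens for \<open>w\<close> or \<open>-w\<close> is where finite coefficients enter: the constant and the linear
  monomials cannot all change at the same rate. The segment stays in the prevariety, hence in the component.
\<close>

lemma component_contains_vertex:
  assumes "0 < k" and poly: "\<And>i. i < k \<Longrightarrow> tropical_polynomial (f i)"
    and fin: "\<And>i. i < k \<Longrightarrow> finite_coefficients (f i)"
    and K: "K \<in> components (tropical_prevariety k f)"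
  obtains v where "v \<in> K" "determining (tight_monomials k f v)"
proof -
  let ?V = "tropical_prevariety k f"
  let ?Z = "Sigma {..<k} (\<lambda>i. dom (f i))"
  note Z = finite_tight_monomials[of k f, OF poly]
  obtain x where "x \<in> K" using in_components_nonempty[OF K] by blast
  have bound: "\<forall>y. y \<in> K \<longrightarrow> card (tight_monomials k f y) < Suc (card ?Z)"
    using card_mono[OF Z(1) Z(2)] by (simp add: less_Suc_eq_le)
  obtain v where v: "v \<in> K" 
    and v_max: "\<And>y. y \<in> K \<Longrightarrow> card (tight_monomials k f y) \<le> card (tight_monomials k f v)"
    using ex_has_greatest_nat[of "\<lambda>y. y \<in> K", OF \<open>x \<in> K\<close> bound] by blast
  have vV: "v \<in> ?V" using v in_components_subset[OF K] by blast
  have "determining (tight_monomials k f v)"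
  proof (rule ccontr)
    assume "\<not> ?thesis"
    then obtain z0 w0 where zw0: "\<forall>p\<in>tight_monomials k f v. affine_form z0 w0 p = 0" "w0 \<noteq> 0"
      unfolding determining_def by blast
    have "\<exists>p\<in>?Z. affine_form z0 w0 p \<noteq> 0"
    proof (rule ccontr)
      assume "\<not> ?thesis"
      then have zero: "affine_form z0 w0 p = 0" if "p \<in> ?Z" for p using that by blast
      have "tropical_zero (f 0) v" using vV \<open>0 < k\<close> by (simp add: tropical_prevariety_def)
      note mon = tropical_zero_imp_linear_monomials[OF poly[OF \<open>0 < k\<close>] fin[OF \<open>0 < k\<close>] this]
      have "z0 0 = 0" using zero[of "(0, 0)"] mon(1) \<open>0 < k\<close> by (simp add: affine_form_def)
      moreover have "exponent_vec (axis j 1) \<bullet> w0 = w0 $ j" for j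
      proof -
        have "exponent_vec (axis j 1) = (axis j 1 :: real ^ 'a)"
          by (simp add: exponent_vec_def axis_def vec_eq_iff)
        then show ?thesis by (simp add: inner_axis')
      qed
      ultimately have "w0 $ j = 0" for j
        using zero[of "(0, axis j 1)"] mon(2)[of j] \<open>0 < k\<close> by (simp add: affine_form_def)
      then show False using \<open>w0 \<noteq> 0\<close> by (simp add: vec_eq_iff)
    qed
    then obtain p0 where p0: "p0 \<in> ?Z" "affine_form z0 w0 p0 \<noteq> 0" by blast
    \<comment> \<open>reverse if necessary\<close>
    \<comment> \<open>The direction is reversed if necessary, so that the monomial \<open>p0\<close> comes closer to being tight.\<close>
    define z where "z = (\<lambda>i. sgn (affine_form z0 w0 p0) * z0 i)"
    define w where "w = sgn (affine_form z0 w0 p0) *\<^sub>R w0"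
    have zw: "affine_form z w p = sgn (affine_form z0 w0 p0) * affine_form z0 w0 p" for p
      by (simp add: z_def w_def affine_form_def algebra_simps)
    have w_tight: "affine_form z w p = 0" if "p \<in> tight_monomials k f v" for p
      using that zw0 by (simp add: zw)
    define \<phi> where "\<phi> = affine_form (\<lambda>i. tropical_value (f i) v) v"
    define s where "s = (\<lambda>p. the (f (fst p) (snd p)) - \<phi> p)"
    have s_nonneg: "0 \<le> s p" if "p \<in> ?Z" for p
      using affine_form_tropical_le[OF poly that, of v] by (simp add: s_def \<phi>_def)
    have tight: "tight_monomials k f (v + t *\<^sub>R w) = {p \<in> ?Z. s p = t * affine_form z w p}"
      if bound: "\<And>p. p \<in> ?Z \<Longrightarrow> t * affine_form z w p \<le> s p" for t
    proof -
      have le: "\<phi> p + t * affine_form z w p \<le> the (f (fst p) (snd p))" if "p \<in> ?Z" for p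
        using bound[OF that] by (simp add: s_def)
      have "tight_monomials k f (v + t *\<^sub>R w)
          = {p \<in> ?Z. \<phi> p + t * affine_form z w p = the (f (fst p) (snd p))}"
        unfolding \<phi>_def
        by (rule tight_monomials_along_line[OF poly vV w_tight le[unfolded \<phi>_def]])
      also have "\<dots> = {p \<in> ?Z. s p = t * affine_form z w p}"
        unfolding s_def by (intro Collect_cong) auto
      finally show ?thesis .
    qed
    have tight_v: "tight_monomials k f v = {p \<in> ?Z. s p = 0}"
      using tight[of 0] s_nonneg by simp
    define N where "N = {p \<in> ?Z. 0 < affine_form z w p}"
    have "p0 \<in> N" using p0 by (auto simp: N_def zw sgn_if)
    have finN: "finite N" unfolding N_def using Z(1) by simp
    have s_pos: "0 < s p" if "p \<in> N" for p
    proof -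
      have "p \<in> ?Z" "affine_form z w p \<noteq> 0" using that by (auto simp: N_def)
      then have "s p \<noteq> 0" using w_tight[of p] unfolding tight_v by blast
      then show ?thesis using s_nonneg[OF \<open>p \<in> ?Z\<close>] by simp
    qed
    \<comment> \<open>The first time at which some monomial outside the tight ones becomes tight.\<close>
    define t where "t = Min ((\<lambda>p. s p / affine_form z w p) ` N)"
    have "t \<in> (\<lambda>p. s p / affine_form z w p) ` N"
      unfolding t_def using finN \<open>p0 \<in> N\<close> by (intro Min_in) auto
    then obtain q where q: "q \<in> N" "t = s q / affine_form z w q" by blast
    have t_pos: "0 < t" using s_pos[OF q(1)] q by (simp add: N_def)
    have t_le: "\<tau> * affine_form z w p \<le> s p" if "0 \<le> \<tau>" "\<tau> \<le> t" "p \<in> ?Z" for \<tau> p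
    proof (cases "p \<in> N")
      case True
      then have "t \<le> s p / affine_form z w p" unfolding t_def using finN by (intro Min_le) auto
      then have "\<tau> \<le> s p / affine_form z w p" using that by simp
      then show ?thesis using True by (simp add: N_def pos_le_divide_eq)
    next
      case False
      then have "\<tau> * affine_form z w p \<le> 0" using that by (auto simp: N_def mult_nonneg_nonpos)
      then show ?thesis using s_nonneg[OF that(3)] by simp
    qed
    have mono: "tight_monomials k f v \<subseteq> tight_monomials k f (v + \<tau> *\<^sub>R w)" if "0 \<le> \<tau>" "\<tau> \<le> t" for \<tau>
    proof
      fix p assume p: "p \<in> tight_monomials k f v"
      then have "p \<in> ?Z" "s p = 0" unfolding tight_v by blast+
      then show "p \<in> tight_monomials k f (v + \<tau> *\<^sub>R w)"
        using tight[of \<tau>] t_le[OF that] w_tight[OF p] by simp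
    qed
    have "v + \<tau> *\<^sub>R w \<in> ?V" if "0 \<le> \<tau>" "\<tau> \<le> t" for \<tau>
      using vV mono[OF that] unfolding tropical_prevariety_iff by blast
    then have "closed_segment v (v + t *\<^sub>R w) \<subseteq> ?V"
      using t_pos by (auto simp: closed_segment_def algebra_simps mult_left_le_one_le)
    then have "closed_segment v (v + t *\<^sub>R w) \<subseteq> K"
      by (rule components_maximal[OF K connected_segment(1)]) (use v in auto)
    then have "v + t *\<^sub>R w \<in> K" by auto
    moreover have "tight_monomials k f v \<subset> tight_monomials k f (v + t *\<^sub>R w)"
    proof -
      have "q \<in> tight_monomials k f (v + t *\<^sub>R w)"
        using tight[OF t_le[of t]] t_pos q by (auto simp: N_def)
      moreover have "q \<notin> tight_monomials k f v" using s_pos[OF q(1)] tight_v by auto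
      ultimately show ?thesis using mono[of t] t_pos by auto
    qed
    then have "card (tight_monomials k f v) < card (tight_monomials k f (v + t *\<^sub>R w))"
      using finite_subset[OF Z(2) Z(1)] by (intro psubset_card_mono)
    ultimately show False using v_max by fastforce
  qed
  with v show thesis by (rule that)
qed

section \<open>The number of components\<close>

text \<open>
  The cells found at the separate vertices together form one disjoint family: between different
  vertices, the coefficients of the polynomials play the part of the height function.
\<close>

lemma card_vertices_le:
  fixes f :: "nat \<Rightarrow> 'n::finite tropical_poly"
  assumes "0 < k" and poly: "\<And>i. i < k \<Longrightarrow> tropical_polynomial (f i)"
    and deg: "\<And>i. i < k \<Longrightarrow> tropical_degree (f i) \<le> d"
    and "finite W" and W: "W \<subseteq> tropical_prevariety k f"
    and det: "\<And>v. v \<in> W \<Longrightarrow> determining (tight_monomials k f v)"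
  shows "real (card W) * (real k - real CARD('n) + 1)
    \<le> real d ^ CARD('n) * real ((k + CARD('n) - 1) choose CARD('n))"
proof -
  note Z = finite_tight_monomials[of k f, OF poly]
  define good where "good = (\<lambda>v (C :: (nat \<times> (nat ^ 'n)) set set). finite C \<and> k + 1 \<le> card C + CARD('n) \<and>
      (\<forall>S\<in>C. S \<subseteq> tight_monomials k f v \<and> cell k S) \<and>
      (\<forall>S\<in>C. \<forall>S'\<in>C. \<forall>N. S \<noteq> S' \<longrightarrow> totals N S \<inter> totals N S' = {}))"
  have "\<exists>C. good v C" if "v \<in> W" for v
    unfolding good_def
  proof (rule many_disjoint_cells[of "tight_monomials k f v" k])
    show "finite (tight_monomials k f v)" using finite_subset[OF Z(2) Z(1)] .
    show "fst ` tight_monomials k f v \<subseteq> {..<k}" by (auto simp: tight_monomials_def)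
    show "determining (tight_monomials k f v)" using det that .
    show "\<exists>I J. I \<noteq> J \<and> (i, I) \<in> tight_monomials k f v \<and> (i, J) \<in> tight_monomials k f v" if "i < k" for i
      using W \<open>v \<in> W\<close> that unfolding subset_iff tropical_prevariety_iff by blast
  qed blast
  then obtain C where C: "\<And>v. v \<in> W \<Longrightarrow> good v (C v)"
    by metis
  have C_fin: "\<And>v. v \<in> W \<Longrightarrow> finite (C v)"
    and C_card: "\<And>v. v \<in> W \<Longrightarrow> k + 1 \<le> card (C v) + CARD('n)"
    and C_tight: "\<And>v S. v \<in> W \<Longrightarrow> S \<in> C v \<Longrightarrow> S \<subseteq> tight_monomials k f v"
    and C_cell: "\<And>v S. v \<in> W \<Longrightarrow> S \<in> C v \<Longrightarrow> cell k S"
    and C_disj: "\<And>v S S' N. v \<in> W \<Longrightarrow> S \<in> C v \<Longrightarrow> S' \<in> C v \<Longrightarrow> S \<noteq> S' \<Longrightarrow> totals N S \<inter> totals N S' = {}"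
    using C unfolding good_def by blast+
  have tight_eq: "affine_form (\<lambda>i. tropical_value (f i) v) v p = the (f (fst p) (snd p))"
    if "v \<in> W" "S \<in> C v" "p \<in> S" for v S p
    using affine_form_tropical_eq C_tight[OF that(1,2)] that(3) by blast
  have inZ: "p \<in> Sigma {..<k} (\<lambda>i. dom (f i))" if "v \<in> W" "S \<in> C v" "p \<in> S" for v S p
    using Z(2) C_tight[OF that(1,2)] that(3) by blast
  have disj: "totals N S \<inter> totals N S' = {}"
    if in_C: "v \<in> W" "S \<in> C v" "v' \<in> W" "S' \<in> C v'" "S \<noteq> S'" for v v' S S' N
  proof (cases "v = v'")
    case False
    have below: "affine_form (\<lambda>i. tropical_value (f i) x) x p \<le> the (f (fst p) (snd p))"
      if "p \<in> S \<union> S'" for p x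
      using affine_form_tropical_le[of k f, OF poly] inZ in_C(1-4) that by blast
    show ?thesis
      by (rule totals_disjoint[OF below below tight_eq[OF in_C(1,2)] tight_eq[OF in_C(3,4)] _ False])
        (use C_cell[OF in_C(1,2)] in \<open>auto simp: cell_def\<close>)
  qed (use in_C C_disj in blast)
  have disjC: "C v \<inter> C v' = {}" if "v \<in> W" "v' \<in> W" "v \<noteq> v'" for v v'
  proof (rule ccontr)
    assume "C v \<inter> C v' \<noteq> {}"
    then obtain S where S: "S \<in> C v" "S \<in> C v'" by blast
    have "v = v'"
      by (rule determining_unique[of S "\<lambda>i. tropical_value (f i) v" v "\<lambda>i. tropical_value (f i) v'" v'])
        (use C_cell S that tight_eq in \<open>auto simp: cell_def\<close>)
    then show False using that by blast
  qed
  let ?C = "\<Union>v\<in>W. C v"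
  have "real (card W) * (real k - real CARD('n) + 1) = (\<Sum>v\<in>W. real k - real CARD('n) + 1)"
    by simp
  also have "\<dots> \<le> (\<Sum>v\<in>W. real (card (C v)))"
    using C_card by (intro sum_mono) (simp add: algebra_simps flip: of_nat_add of_nat_Suc)
  also have "\<dots> = real (card ?C)"
    using disjC C_fin \<open>finite W\<close> by (simp add: card_UN_disjoint)
  also have "\<dots> \<le> real d ^ CARD('n) * real ((k + CARD('n) - 1) choose CARD('n))"
  proof (rule card_disjoint_cells_le)
    show "finite ?C" using \<open>finite W\<close> C_fin by simp
    show "monomial_degree (snd p) \<le> d" if "S \<in> ?C" "p \<in> S" for S p
    proof -
      from that(1) obtain v where "v \<in> W" "S \<in> C v" by blast
      from inZ[OF this that(2)] have "fst p < k" "snd p \<in> dom (f (fst p))" by auto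
      then show ?thesis using monomial_degree_le[OF poly] deg le_trans by blast
    qed
  qed (use C_cell disj \<open>0 < k\<close> in blast)+
  finally show ?thesis .
qed

theorem corollary6p4:
  fixes f :: "nat \<Rightarrow> 'n::finite tropical_poly"
    and k d :: nat
    and V :: "(real ^ 'n) set"
  assumes "CARD('n) \<le> k"
    and "\<And>i. i < k \<Longrightarrow> tropical_polynomial (f i)"
    and "\<And>i. i < k \<Longrightarrow> tropical_degree (f i) \<le> d"
    and "\<And>i. i < k \<Longrightarrow> finite_coefficients (f i)"
    and "V = tropical_prevariety k f"
  shows "finite (components V) \<and>
    real (card (components V)) \<le>
      real d ^ CARD('n) / (real k - real CARD('n) + 1) * real ((k + CARD('n) - 1) choose CARD('n))"
proof -
  let ?B = "real d ^ CARD('n) / (real k - real CARD('n) + 1) * real ((k + CARD('n) - 1) choose CARD('n))"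
  have "0 < CARD('n)" by simp
  with assms(1) have "0 < k" by linarith
  have pos: "0 < real k - real CARD('n) + 1" using assms(1) by simp
  have "\<exists>v. v \<in> K \<and> determining (tight_monomials k f v)" if "K \<in> components V" for K
    using component_contains_vertex[OF \<open>0 < k\<close> assms(2,4) that[unfolded assms(5)]] by blast
  then obtain vertex where vertex: "\<And>K. K \<in> components V \<Longrightarrow> vertex K \<in> K"
    and det: "\<And>K. K \<in> components V \<Longrightarrow> determining (tight_monomials k f (vertex K))"
    by metis
  have inj: "inj_on vertex (components V)"
    by (rule inj_onI) (metis vertex components_nonoverlap disjoint_iff)
  have "card G \<le> nat \<lfloor>?B\<rfloor>" if "G \<subseteq> components V" "finite G" for G
  proof -
    have "vertex ` G \<subseteq> tropical_prevariety k f"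
      using that(1) vertex in_components_subset assms(5) by blast
    then have "real (card (vertex ` G)) * (real k - real CARD('n) + 1)
      \<le> real d ^ CARD('n) * real ((k + CARD('n) - 1) choose CARD('n))"
      using that det by (intro card_vertices_le[OF \<open>0 < k\<close> assms(2,3)]) auto
    then have "real (card G) \<le> ?B"
      using pos card_image[OF inj_on_subset[OF inj that(1)]] by (simp add: field_simps)
    then show ?thesis by (simp add: le_nat_floor)
  qed
  then have "finite (components V) \<and> card (components V) \<le> nat \<lfloor>?B\<rfloor>"
    by (rule finite_if_finite_subsets_card_bdd)
  moreover have "0 \<le> ?B" using pos by simp
  ultimately show ?thesis by (simp add: le_nat_iff le_floor_iff)
qed

thm_deps corollary6p4

end
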